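(* Let $n\ge 3$ be odd. The randomized protocol RandomHalfInConcert$_n$ has worst-case expected cost exactly $\frac{n+1}{2}$.
   Context: Two agents sit at two distinct sites among $V=\{0,\ldots,n-1\}$ and search for each other by queries "is there an agent at site $j$?"; the execution ends at the first query made by one agent to the site of the other. Protocol RandomHalfInConcert$_n$ ($n$ odd, $m=(n-1)/2$): an agent at site $i$ has target set $S_i=\{(i+1)\bmod n,\ldots,(i+m)\bmod n\}$ and independently chooses a uniformly random ordering $s_{i,1},\ldots,s_{i,m}$ of $S_i$. Querying proceeds in rounds $r=1,2,\ldots,m$; within round $r$, the sites $0,1,\ldots,n-1$ take turns in increasing order, and each site occupied by an agent queries $s_{i,r}$. The cost of an execution is the total number of queries made by both agents up to and including the first successful query. The worst-case expected cost is the maximum, over all placements of the two agents, of the expected cost (expectation over the agents' random orderings). *)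

theory Defs
  imports "HOL-Probability.Probability" "HOL-Combinatorics.Multiset_Permutations"
begin

definition half_size :: "nat \<Rightarrow> nat" where
  "half_size n = (n - 1) div 2"

definition target_set :: "nat \<Rightarrow> nat \<Rightarrow> nat set" where
  "target_set n i = (\<lambda>k. (i + k) mod n) ` {1..half_size n}"

definition ordering_pmf :: "nat \<Rightarrow> nat \<Rightarrow> nat list pmf" where
  "ordering_pmf n i = pmf_of_set (permutations_of_set (target_set n i))"

text \<open>A placement is the set of the two occupied sites. The behaviour of the protocol depends
  only on this set, so the two agents need not be distinguished.\<close>

definition placements :: "nat \<Rightarrow> nat set set" where
  "placements n = {A. A \<subseteq> {..<n} \<and> card A = 2}"

text \<open>Independent uniformly random orderings for the occupied sites; unoccupied sites get the
  dummy value \<^term>\<open>[]\<close>, which is never read.\<close>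

definition orderings_pmf :: "nat \<Rightarrow> nat set \<Rightarrow> (nat \<Rightarrow> nat list) pmf" where
  "orderings_pmf n A = Pi_pmf A [] (ordering_pmf n)"

text \<open>The schedule of all queries \<open>(querying site, queried site)\<close> in chronological order, as if
  the execution did not stop at a success. Rounds are numbered from \<open>0\<close>, so that the ordering
  \<open>s\<^sub>i\<^sub>,\<^sub>1, \<dots>, s\<^sub>i\<^sub>,\<^sub>m\<close> is the list \<^term>\<open>s i\<close>.\<close>

definition query_schedule :: "nat \<Rightarrow> nat set \<Rightarrow> (nat \<Rightarrow> nat list) \<Rightarrow> (nat \<times> nat) list" where
  "query_schedule n A s = [(i, s i ! r). r \<leftarrow> [0..<half_size n], i \<leftarrow> [0..<n], i \<in> A]"

definition successful :: "nat set \<Rightarrow> nat \<times> nat \<Rightarrow> bool" where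
  "successful A q \<longleftrightarrow> snd q \<in> A \<and> snd q \<noteq> fst q"

text \<open>The number of entries up to and including the first one satisfying \<open>P\<close>
  (all entries, if there is none).\<close>

fun count_until :: "('a \<Rightarrow> bool) \<Rightarrow> 'a list \<Rightarrow> nat" where
  "count_until P [] = 0"
| "count_until P (x # xs) = (if P x then 1 else Suc (count_until P xs))"

definition execution_cost :: "nat \<Rightarrow> nat set \<Rightarrow> (nat \<Rightarrow> nat list) \<Rightarrow> nat" where
  "execution_cost n A s = count_until (successful A) (query_schedule n A s)"

definition expected_cost :: "nat \<Rightarrow> nat set \<Rightarrow> real" where
  "expected_cost n A =
     measure_pmf.expectation (orderings_pmf n A) (\<lambda>s. real (execution_cost n A s))"

definition worst_case_expected_cost :: "nat \<Rightarrow> real" where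
  "worst_case_expected_cost n = Max (expected_cost n ` placements n)"

end

theory Submission
  imports Defs
begin

text \<open>For sites \<open>i < j\<close> exactly one of the two agents has the other in its target set, so only
  that agent can succeed, and the position of the other site in its ordering is uniform with mean
  \<open>(m + 1) / 2\<close> by symmetry under list reversal. A success in round \<open>r\<close> costs \<open>2 r - 1\<close> queries if
  it is made by \<open>i\<close> and \<open>2 r\<close> if it is made by \<open>j\<close>, which gives the expected costs \<open>m\<close> and \<open>m + 1\<close>.
  The second case occurs for the placement \<open>{0, n - 1}\<close>.\<close>

section \<open>Positions of first hits in lists and in random permutations\<close>

lemma count_until_map: "count_until P (map f xs) = count_until (P \<circ> f) xs"
  by (induction xs) auto

lemma count_until_append:
  "count_until P (xs @ ys) =
     (if \<exists>x\<in>set xs. P x then count_until P xs else length xs + count_until P ys)"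
  by (induction xs) auto

text \<open>In a distinct list of length \<open>L\<close> the element \<open>x\<close> has a single
  position \<open>p\<close>, which reversal moves to \<open>L + 1 - p\<close>.\<close>

lemma count_until_rev:
  assumes "distinct xs" "x \<in> set xs"
  shows "count_until (\<lambda>y. y = x) xs + count_until (\<lambda>y. y = x) (rev xs) = length xs + 1"
  using assms by (induction xs) (auto simp: count_until_append)

text \<open>A first hit by \<open>f\<close> in round \<open>r\<close> comes after
  \<open>r - 1\<close> full rounds of two entries, hence at position \<open>2 * r - 1\<close>; the
  \<open>+ 1\<close> avoids truncated subtraction. A hit must exist, since otherwise
  \<open>count_until\<close> returns the full length and the two sides differ by one.\<close>

lemma count_until_interleave_left:
  assumes "\<And>r. r \<in> set rs \<Longrightarrow> \<not> P (g r)" "\<exists>r\<in>set rs. P (f r)"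
  shows "count_until P (concat (map (\<lambda>r. [f r, g r]) rs)) + 1 = 2 * count_until (P \<circ> f) rs"
  using assms by (induction rs) auto

text \<open>A hit by \<open>g\<close> in round \<open>r\<close> closes that round and so has
  position \<open>2 * r\<close>. If there is no hit, both sides are
  \<open>2 * length rs\<close>.\<close>

lemma count_until_interleave_right:
  assumes "\<And>r. r \<in> set rs \<Longrightarrow> \<not> P (f r)"
  shows "count_until P (concat (map (\<lambda>r. [f r, g r]) rs)) = 2 * count_until (P \<circ> g) rs"
  using assms by (induction rs) auto

lemma expectation_position_permutation:
  assumes "finite A" "x \<in> A"
  shows "measure_pmf.expectation (pmf_of_set (permutations_of_set A))
           (\<lambda>xs. real (count_until (\<lambda>y. y = x) xs)) = (real (card A) + 1) / 2"
proof -
  let ?p = "pmf_of_set (permutations_of_set A)"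
  let ?f = "\<lambda>xs. real (count_until (\<lambda>y. y = x) xs)"
  have fin: "finite (permutations_of_set A)" and ne: "permutations_of_set A \<noteq> {}"
    using assms by auto
  have int: "integrable (measure_pmf ?p) h" for h :: "'a list \<Rightarrow> real"
    using fin ne by (intro integrable_measure_pmf_finite) auto
  \<comment> \<open>Reversal is an involution on the orderings of \<open>A\<close>, so it preserves
    the uniform distribution. Averaging a position with its mirror image then replaces a sum over
    all orderings by a constant.\<close>
  have "bij_betw rev (permutations_of_set A) (permutations_of_set A)"
    by (rule bij_betwI[of _ _ _ rev]) (auto simp: permutations_of_set_def)
  then have "map_pmf rev ?p = ?p"
    using fin ne by (intro map_pmf_of_set_bij_betw)
  then have "measure_pmf.expectation ?p ?f = measure_pmf.expectation (map_pmf rev ?p) ?f"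
    by simp
  also have "\<dots> = measure_pmf.expectation ?p (\<lambda>xs. ?f (rev xs))"
    by simp
  finally have "2 * measure_pmf.expectation ?p ?f =
      measure_pmf.expectation ?p (\<lambda>xs. ?f xs + ?f (rev xs))"
    by (simp add: int)
  also have "\<dots> = measure_pmf.expectation ?p (\<lambda>_. real (card A) + 1)"
  proof (rule integral_cong_AE)
    show "AE xs in ?p. ?f xs + ?f (rev xs) = real (card A) + 1"
    proof (rule AE_pmfI)
      fix xs assume "xs \<in> set_pmf ?p"
      then have "distinct xs" "set xs = A"
        using fin ne by (auto simp: permutations_of_set_def)
      then show "?f xs + ?f (rev xs) = real (card A) + 1"
        using count_until_rev[of xs x] assms(2) distinct_card[of xs] by simp
    qed
  qed simp_all
  finally show ?thesis by simp
qed

section \<open>Size and membership of target sets\<close>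

lemma inj_on_add_mod:
  fixes i n :: nat
  shows "inj_on (\<lambda>k. (i + k) mod n) {..<n}"
proof (rule linorder_inj_onI')
  fix k l assume "k \<in> {..<n}" "l \<in> {..<n}" "k < l"
  then have "\<not> n dvd l - k" by (auto dest: dvd_imp_le)
  then show "(i + k) mod n \<noteq> (i + l) mod n"
    using \<open>k < l\<close> mod_eq_dvd_iff_nat[of "i + k" "i + l" n] by auto
qed

lemma card_target_set: "card (target_set n i) = half_size n"
proof (cases "n = 0")
  case False
  then have "{1..half_size n} \<subseteq> {..<n}" by (auto simp: half_size_def)
  then have "inj_on (\<lambda>k. (i + k) mod n) {1..half_size n}"
    using inj_on_add_mod inj_on_subset by blast
  from card_image[OF this] show ?thesis by (simp add: target_set_def)
qed (simp add: target_set_def half_size_def)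

lemma finite_target_set: "finite (target_set n i)"
  by (simp add: target_set_def)

lemma higher_site_in_target_set_iff:
  assumes "i < j" "j < n"
  shows "j \<in> target_set n i \<longleftrightarrow> j - i \<le> half_size n"
proof
  assume "j \<in> target_set n i"
  then obtain k where k: "1 \<le> k" "k \<le> half_size n" "j = (i + k) mod n"
    by (auto simp: target_set_def)
  \<comment> \<open>A residue never exceeds the number reduced, so wraparound needs no separate
    case.\<close>
  then have "j \<le> i + k" by simp
  then show "j - i \<le> half_size n" using k(2) by linarith
next
  assume "j - i \<le> half_size n"
  then show "j \<in> target_set n i"
    unfolding target_set_def using assms by (intro image_eqI[of _ _ "j - i"]) auto
qed

lemma lower_site_in_target_set_iff:
  assumes "i < j" "j < n"
  shows "i \<in> target_set n j \<longleftrightarrow> n \<le> half_size n + (j - i)"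
proof
  assume "i \<in> target_set n j"
  then obtain k where k: "1 \<le> k" "k \<le> half_size n" "i = (j + k) mod n"
    by (auto simp: target_set_def)
  \<comment> \<open>A site below \<open>j\<close> is reached only by wrapping around: without it,
    \<open>i = j + k > j\<close>. As \<open>k < n\<close>, there is exactly one wrap.\<close>
  have "n \<le> j + k"
  proof (rule ccontr)
    assume "\<not> n \<le> j + k"
    then show False using k assms by simp
  qed
  moreover have "j + k - n < n" using k assms by (auto simp: half_size_def)
  ultimately have "i = j + k - n" using k by (simp add: le_mod_geq)
  then show "n \<le> half_size n + (j - i)" using assms k \<open>n \<le> j + k\<close> by simp
next
  assume *: "n \<le> half_size n + (j - i)"
  show "i \<in> target_set n j"
    unfolding target_set_def
  proof (rule image_eqI[of _ _ "n - (j - i)"])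
    have "j + (n - (j - i)) = i + n" using assms by simp
    then show "i = (j + (n - (j - i))) mod n" using assms by simp
  qed (use assms * in auto)
qed

section \<open>Execution cost for two occupied sites\<close>

lemma query_schedule_pair:
  assumes "i < j" "j < n"
  shows "query_schedule n {i, j} s =
           concat (map (\<lambda>r. [(i, s i ! r), (j, s j ! r)]) [0..<half_size n])"
proof -
  have *: "concat (map (\<lambda>k. if k \<in> {i, j} then [f k] else []) ks) =
        map f (filter (\<lambda>k. k \<in> {i, j}) ks)"
    for f :: "nat \<Rightarrow> nat \<times> nat" and ks
    by (induction ks) auto
  \<comment> \<open>Turns are taken in increasing order of sites, so \<open>i\<close> queries before
    \<open>j\<close> in every round; this is the source of the asymmetry between the two
    costs.\<close>
  have "filter (\<lambda>k. k \<in> {i, j}) [0..<n] = [i, j]"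
    using assms
    by (intro sorted_distinct_set_unique) (auto simp: sorted_wrt_filter)
  then show ?thesis
    unfolding query_schedule_def * by simp
qed

lemma AE_orderings_pmf:
  assumes "finite A" "k \<in> A"
  shows "AE s in orderings_pmf n A. s k \<in> permutations_of_set (target_set n k)"
proof (rule AE_pmfI)
  fix s assume "s \<in> set_pmf (orderings_pmf n A)"
  then show "s k \<in> permutations_of_set (target_set n k)"
    using assms
    by (auto simp: orderings_pmf_def set_Pi_pmf PiE_dflt_def ordering_pmf_def finite_target_set)
qed

text \<open>The component at \<open>k\<close> of the product distribution is the uniform ordering of
  \<open>target_set n k\<close>, so the mean for a single permutation applies.\<close>

lemma expectation_position_orderings_pmf:
  assumes "finite A" "k \<in> A" "x \<in> target_set n k"
  shows "measure_pmf.expectation (orderings_pmf n A)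
           (\<lambda>s. real (count_until (\<lambda>y. y = x) (s k))) = (real (half_size n) + 1) / 2"
proof -
  have "measure_pmf.expectation (orderings_pmf n A) (\<lambda>s. real (count_until (\<lambda>y. y = x) (s k))) =
      measure_pmf.expectation (map_pmf (\<lambda>s. s k) (orderings_pmf n A))
        (\<lambda>xs. real (count_until (\<lambda>y. y = x) xs))"
    by simp
  also have "map_pmf (\<lambda>s. s k) (orderings_pmf n A) = ordering_pmf n k"
    using assms by (simp add: orderings_pmf_def Pi_pmf_component)
  finally show ?thesis
    using expectation_position_permutation[OF finite_target_set assms(3)]
    by (simp add: ordering_pmf_def card_target_set)
qed

lemma integrable_orderings_pmf:
  fixes f :: "(nat \<Rightarrow> nat list) \<Rightarrow> real"
  assumes "finite A"
  shows "integrable (measure_pmf (orderings_pmf n A)) f"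
proof (rule integrable_measure_pmf_finite)
  show "finite (set_pmf (orderings_pmf n A))"
    using assms
    by (auto simp: orderings_pmf_def set_Pi_pmf ordering_pmf_def finite_target_set
        intro!: finite_PiE_dflt)
qed

lemma permutation_target_setD:
  assumes "xs \<in> permutations_of_set (target_set n k)"
  shows "set xs = target_set n k" "length xs = half_size n"
  using assms by (simp_all add: permutations_of_setD length_finite_permutations_of_set
      card_target_set)

lemma execution_cost_lower_succeeds:
  assumes "i < j" "j < n" "set (s j) = target_set n j" "i \<notin> target_set n j"
    and "length (s i) = half_size n" "length (s j) = half_size n" "j \<in> set (s i)"
  shows "execution_cost n {i, j} s + 1 = 2 * count_until (\<lambda>y. y = j) (s i)"
proof -
  let ?P = "successful {i, j}" and ?f = "\<lambda>r. (i, s i ! r)" and ?rs = "[0..<half_size n]"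
  have "execution_cost n {i, j} s + 1 = 2 * count_until (?P \<circ> ?f) ?rs"
    unfolding execution_cost_def query_schedule_pair[OF assms(1,2)]
  proof (rule count_until_interleave_left)
    show "\<not> ?P (j, s j ! r)" if "r \<in> set ?rs" for r
      using that assms nth_mem[of r "s j"] by (auto simp: successful_def)
    show "\<exists>r\<in>set ?rs. ?P (?f r)"
      using assms by (auto simp: successful_def in_set_conv_nth)
  qed
  \<comment> \<open>A query made from \<open>i\<close> can only succeed at the other occupied site
    \<open>j\<close>.\<close>
  also have "?P \<circ> ?f = (\<lambda>y. y = j) \<circ> (!) (s i)"
    using assms(1) by (auto simp: successful_def fun_eq_iff)
  also have "count_until \<dots> ?rs = count_until (\<lambda>y. y = j) (s i)"
    using assms(5) map_nth[of "s i"] by (simp flip: count_until_map)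
  finally show ?thesis .
qed

lemma execution_cost_higher_succeeds:
  assumes "i < j" "j < n" "set (s i) = target_set n i" "j \<notin> target_set n i"
    and "length (s i) = half_size n" "length (s j) = half_size n"
  shows "execution_cost n {i, j} s = 2 * count_until (\<lambda>y. y = i) (s j)"
proof -
  let ?P = "successful {i, j}" and ?g = "\<lambda>r. (j, s j ! r)" and ?rs = "[0..<half_size n]"
  have "execution_cost n {i, j} s = 2 * count_until (?P \<circ> ?g) ?rs"
    unfolding execution_cost_def query_schedule_pair[OF assms(1,2)]
  proof (rule count_until_interleave_right)
    show "\<not> ?P (i, s i ! r)" if "r \<in> set ?rs" for r
      using that assms nth_mem[of r "s i"] by (auto simp: successful_def)
  qed
  also have "?P \<circ> ?g = (\<lambda>y. y = i) \<circ> (!) (s j)"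
    using assms(1) by (auto simp: successful_def fun_eq_iff)
  also have "count_until \<dots> ?rs = count_until (\<lambda>y. y = i) (s j)"
    using assms(6) map_nth[of "s j"] by (simp flip: count_until_map)
  finally show ?thesis .
qed

section \<open>Expected cost by distance between the sites\<close>

lemma expected_cost_near:
  assumes "i < j" "j < n" "j - i \<le> half_size n" "odd n"
  shows "expected_cost n {i, j} = real (half_size n)"
proof -
  have mem: "j \<in> target_set n i"
    using assms by (simp add: higher_site_in_target_set_iff)
  \<comment> \<open>With \<open>n = 2 * m + 1\<close> and \<open>j - i \<le> m\<close>, the sum
    \<open>m + (j - i)\<close> is at most \<open>2 * m < n\<close>.\<close>
  have nmem: "i \<notin> target_set n j"
    using assms by (auto simp: lower_site_in_target_set_iff half_size_def elim!: oddE)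
  let ?M = "orderings_pmf n {i, j}"
  let ?c = "\<lambda>s. real (count_until (\<lambda>y. y = j) (s i))"
  have "expected_cost n {i, j} = measure_pmf.expectation ?M (\<lambda>s. 2 * ?c s - 1)"
    unfolding expected_cost_def
  \<comment> \<open>The cost formula needs \<open>s i\<close> and \<open>s j\<close> to be genuine
    orderings of their target sets, which holds almost surely.\<close>
  proof (rule integral_cong_AE)
    have "AE s in ?M. s i \<in> permutations_of_set (target_set n i)"
      "AE s in ?M. s j \<in> permutations_of_set (target_set n j)"
      by (simp_all add: AE_orderings_pmf)
    then show "AE s in ?M. real (execution_cost n {i, j} s) = 2 * ?c s - 1"
    proof eventually_elim
      case (elim s)
      then show ?case
        using execution_cost_lower_succeeds[of i j n s] assms(1,2) mem nmem
        by (simp add: permutation_target_setD)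
    qed
  qed simp_all
  also have "\<dots> = 2 * measure_pmf.expectation ?M ?c - 1"
    by (simp add: integrable_orderings_pmf)
  finally show ?thesis
    using mem by (simp add: expectation_position_orderings_pmf field_simps)
qed

lemma expected_cost_far:
  assumes "i < j" "j < n" "j - i > half_size n" "odd n"
  shows "expected_cost n {i, j} = real (half_size n) + 1"
proof -
  have nmem: "j \<notin> target_set n i"
    using assms by (simp add: higher_site_in_target_set_iff)
  \<comment> \<open>Here \<open>j - i \<ge> m + 1\<close>, so \<open>m + (j - i)\<close> reaches
    \<open>2 * m + 1 = n\<close>.\<close>
  have mem: "i \<in> target_set n j"
    using assms by (auto simp: lower_site_in_target_set_iff half_size_def elim!: oddE)
  let ?M = "orderings_pmf n {i, j}"
  let ?c = "\<lambda>s. real (count_until (\<lambda>y. y = i) (s j))"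
  have "expected_cost n {i, j} = measure_pmf.expectation ?M (\<lambda>s. 2 * ?c s)"
    unfolding expected_cost_def
  proof (rule integral_cong_AE)
    have "AE s in ?M. s i \<in> permutations_of_set (target_set n i)"
      "AE s in ?M. s j \<in> permutations_of_set (target_set n j)"
      by (simp_all add: AE_orderings_pmf)
    then show "AE s in ?M. real (execution_cost n {i, j} s) = 2 * ?c s"
    proof eventually_elim
      case (elim s)
      then show ?case
        using execution_cost_higher_succeeds[of i j n s] assms(1,2) nmem
        by (simp add: permutation_target_setD)
    qed
  qed simp_all
  also have "\<dots> = 2 * measure_pmf.expectation ?M ?c"
    by simp
  finally show ?thesis
    using mem by (simp add: expectation_position_orderings_pmf field_simps)
qed

lemma placementsE:
  assumes "A \<in> placements n"
  obtains i j where "A = {i, j}" "i < j" "j < n"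
proof -
  obtain x y where "A = {x, y}" "x \<noteq> y"
    using assms by (auto simp: placements_def card_2_iff)
  then show thesis
    using assms that[of x y] that[of y x]
    by (cases x y rule: linorder_cases) (auto simp: placements_def)
qed

theorem theorem4:
  fixes n :: nat
  assumes "n \<ge> 3" and "odd n"
  shows "worst_case_expected_cost n = (real n + 1) / 2"
proof -
  have half: "real (half_size n) + 1 = (real n + 1) / 2"
    using assms(2) by (auto simp: half_size_def elim!: oddE)
  have "Max (expected_cost n ` placements n) = real (half_size n) + 1"
  proof (rule Max_eqI)
    have "placements n \<subseteq> Pow {..<n}" by (auto simp: placements_def)
    then show "finite (expected_cost n ` placements n)"
      by (auto intro: finite_subset)
  next
    fix c assume "c \<in> expected_cost n ` placements n"
    then obtain i j where ij: "c = expected_cost n {i, j}" "i < j" "j < n"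
      by (auto elim: placementsE)
    then show "c \<le> real (half_size n) + 1"
      using expected_cost_near[of i j n] expected_cost_far[of i j n] assms(2)
      by (cases "j - i \<le> half_size n") auto
  next
    \<comment> \<open>The distance \<open>n - 1 = 2 * m\<close> exceeds \<open>m\<close> because
      \<open>n \<ge> 3\<close> gives \<open>m \<ge> 1\<close>, so the upper bound is
      attained.\<close>
    have "expected_cost n {0, n - 1} = real (half_size n) + 1"
      using assms by (intro expected_cost_far) (auto simp: half_size_def elim!: oddE)
    moreover have "{0, n - 1} \<in> placements n"
      using assms(1) by (auto simp: placements_def)
    ultimately show "real (half_size n) + 1 \<in> expected_cost n ` placements n"
      by (metis imageI)
  qed
  then show ?thesis
    by (simp add: worst_case_expected_cost_def half)
qed

end
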